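(* Let $P=\{x\in\mathbb{R}^n \mid (x,a_i)+b_i\geq 0,\ i=1,\dots,m\}$ be a simple $n$-dimensional polytope with $m$ facets. Then the moment-angle manifold $Z_P$ is homeomorphic to the real moment-angle manifold $R_{L(P)}$, where $L(P)$ is the double of $P$.
   Context: Let $P=\{x\in\mathbb{R}^n \mid (x,a_i)+b_i\geq 0,\ i=1,\dots,m\}$, with $a_i\in\mathbb{R}^n$ and $b_i\in\mathbb{R}$, be a simple $n$-dimensional (bounded) polytope with exactly $m$ facets (so each inequality defines a facet). Let $i_P:\mathbb{R}^n\to\mathbb{R}^m$ be the affine map $i_P(x)=A_Px+b_P$, where $A_P$ is the $m\times n$ matrix with rows $a_i$ and $b_P=(b_1,\dots,b_m)$ is a column vector. Then $i_P$ identifies $P$ with $i_P(P)=i_P(\mathbb{R}^n)\cap\mathbb{R}^m_{\geq}$, where $\mathbb{R}^m_{\geq}$ is the set of points with all coordinates nonnegative. Specify the affine subspace $i_P(\mathbb{R}^n)\subset\mathbb{R}^m$ by a system of $m-n$ linear equations $$\sum_{i=1}^m c_{j,i}x_i=q_j,\qquad j=1,\dots,m-n.$$ The double of $P$ is the polytope $$L(P)=\Bigl\{(x_1,\dots,x_m,x_1',\dots,x_m')\in\mathbb{R}^{2m}_{\geq}\ \Bigm|\ \sum_{i=1}^m c_{j,i}(x_i+x_i')=q_j,\ j=1,\dots,m-n\Bigr\};$$ it is a simple $(m+n)$-dimensional polytope with $2m$ facets. Moment-angle manifold: let $\mu:\mathbb{C}^m\to\mathbb{R}^m_{\geq}$,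 $\mu(z_1,\dots,z_m)=(|z_1|^2,\dots,|z_m|^2)$; then $Z_P=\mu^{-1}(i_P(P))\subset\mathbb{C}^m$ with the subspace topology. Real moment-angle manifold: let $\pi:\mathbb{R}^m\to\mathbb{R}^m_{\geq}$, $\pi(x_1,\dots,x_m)=(x_1^2,\dots,x_m^2)$; then $R_P=\pi^{-1}(i_P(P))\subset\mathbb{R}^m$ with the subspace topology. For the double, which is already embedded in $\mathbb{R}^{2m}_{\geq}$ by its $2m$ facet coordinates, $R_{L(P)}$ is the preimage of $L(P)\subset\mathbb{R}^{2m}_{\geq}$ under the coordinatewise squaring map $\mathbb{R}^{2m}\to\mathbb{R}^{2m}_{\geq}$. *)

theory Defs
  imports "HOL-Analysis.Analysis"
begin

text \<open>
  The dimension \<open>n\<close> is \<open>CARD('n)\<close> and the number \<open>m\<close> of inequalities is \<open>CARD('m)\<close>.  The normal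
  vectors \<open>a\<^sub>i\<close> are the rows \<open>A $ i\<close> of a matrix \<open>A\<close>.  Points
  \<open>(x\<^sub>1, \<dots>, x\<^sub>m, x\<^sub>1', \<dots>, x\<^sub>m')\<close> of \<open>2m\<close>-space are vectors \<open>y :: real ^ ('m + 'm)\<close>, where
  \<open>x\<^sub>i\<close> is \<open>y $ Inl i\<close> and \<open>x\<^sub>i'\<close> is \<open>y $ Inr i\<close>.
\<close>

definition halfspace_polyhedron :: "real ^ 'n ^ 'm \<Rightarrow> real ^ 'm \<Rightarrow> (real ^ 'n) set" where
  "halfspace_polyhedron A b = {x. \<forall>i. x \<bullet> (A $ i) + b $ i \<ge> 0}"

text \<open>
  The predicate \<open>polytope\<close> of the library includes boundedness (it means the convex hull of a finite
  set).  Vertices are extreme points.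
\<close>

definition simple_polytope :: "'a::euclidean_space set \<Rightarrow> bool" where
  "simple_polytope P \<longleftrightarrow>
     polytope P \<and>
     (\<forall>v. v extreme_point_of P \<longrightarrow> int (card {F. F facet_of P \<and> v \<in> F}) = aff_dim P)"

definition facet_embedding :: "real ^ 'n ^ 'm \<Rightarrow> real ^ 'm \<Rightarrow> real ^ 'n \<Rightarrow> real ^ 'm" where
  "facet_embedding A b x = A *v x + b"

definition affine_system_solutions ::
    "nat \<Rightarrow> (nat \<Rightarrow> 'm::finite \<Rightarrow> real) \<Rightarrow> (nat \<Rightarrow> real) \<Rightarrow> (real ^ 'm) set" where
  "affine_system_solutions k c q = {x. \<forall>j\<in>{1..k}. (\<Sum>i\<in>UNIV. c j i * x $ i) = q j}"

definition polytope_double ::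
    "nat \<Rightarrow> (nat \<Rightarrow> 'm::finite \<Rightarrow> real) \<Rightarrow> (nat \<Rightarrow> real) \<Rightarrow> (real ^ ('m + 'm)) set" where
  "polytope_double k c q =
     {y. (\<forall>s. y $ s \<ge> 0) \<and>
         (\<forall>j\<in>{1..k}. (\<Sum>i\<in>UNIV. c j i * (y $ Inl i + y $ Inr i)) = q j)}"

definition moment_map :: "complex ^ 'm \<Rightarrow> real ^ 'm" where
  "moment_map z = (\<chi> i. (cmod (z $ i))\<^sup>2)"

definition square_map :: "real ^ 'k \<Rightarrow> real ^ 'k" where
  "square_map x = (\<chi> i. (x $ i)\<^sup>2)"

definition moment_angle_manifold :: "real ^ 'n ^ 'm \<Rightarrow> real ^ 'm \<Rightarrow> (complex ^ 'm) set" where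
  "moment_angle_manifold A b = moment_map -` (facet_embedding A b ` halfspace_polyhedron A b)"

text \<open>
  The argument is a polytope already embedded in the nonnegative orthant by its facet coordinates:
  \<open>facet_embedding A b ` P\<close> for a polytope \<open>P\<close> given by inequalities, and the double as it stands.
\<close>

definition real_moment_angle_manifold :: "(real ^ 'k) set \<Rightarrow> (real ^ 'k) set" where
  "real_moment_angle_manifold Q = square_map -` Q"

end

theory Submission
  imports Defs
begin

text \<open>
  Splitting a complex coordinate into its real and imaginary parts turns
  \<open>\<bar>z\<bar>\<^sup>2\<close> into \<open>x\<^sup>2 + x'\<^sup>2\<close>.  The equations of \<open>L(P)\<close> depend on \<open>x\<close> and \<open>x'\<close> only through
  \<open>x + x'\<close>, so the defining equations of \<open>Z\<^sub>P\<close>, written in real coordinates, are literally those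
  of the real moment-angle manifold of \<open>L(P)\<close>.  The standard identification of complex \<open>m\<close>-space with real \<open>2m\<close>-space therefore
  restricts to the homeomorphism.

  Only the equations have to be compared, because the inequalities are automatic on both sides:
  the embedded polytope is the part of the affine subspace lying in the nonnegative orthant
  (lemma \<open>facet_embedding_polyhedron\<close>), and moduli squared and real squares are nonnegative.
  The substance is the resulting identity of sets, \<open>moment_angle_manifold_eq_vimage\<close>.
\<close>

definition real_coordinates :: "complex ^ 'm \<Rightarrow> real ^ ('m + 'm)" where
  "real_coordinates z = (\<chi> s. case s of Inl i \<Rightarrow> Re (z $ i) | Inr i \<Rightarrow> Im (z $ i))"

definition complex_coordinates :: "real ^ ('m + 'm) \<Rightarrow> complex ^ 'm" where
  "complex_coordinates y = (\<chi> i. Complex (y $ Inl i) (y $ Inr i))"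

lemma real_coordinates_nth [simp]:
  "real_coordinates z $ Inl i = Re (z $ i)"
  "real_coordinates z $ Inr i = Im (z $ i)"
  by (simp_all add: real_coordinates_def)

lemma complex_coordinates_real_coordinates [simp]:
  "complex_coordinates (real_coordinates z) = z"
  by (simp add: complex_coordinates_def vec_eq_iff)

lemma real_coordinates_complex_coordinates [simp]:
  "real_coordinates (complex_coordinates y) = y"
  by (simp add: real_coordinates_def complex_coordinates_def vec_eq_iff split: sum.split)

lemma homeomorphism_real_coordinates:
  "homeomorphism UNIV UNIV (real_coordinates :: complex ^ 'm \<Rightarrow> _) complex_coordinates"
proof (rule homeomorphismI)
  have "continuous_on UNIV (\<lambda>z :: complex ^ 'm. case s of Inl i \<Rightarrow> Re (z $ i) | Inr i \<Rightarrow> Im (z $ i))"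
    for s :: "'m + 'm"
    by (cases s) (simp_all add: continuous_intros)
  then show "continuous_on UNIV (real_coordinates :: complex ^ 'm \<Rightarrow> _)"
    unfolding real_coordinates_def by (rule continuous_on_vec_lambda)
  show "continuous_on UNIV (complex_coordinates :: _ \<Rightarrow> complex ^ 'm)"
    unfolding complex_coordinates_def Complex_eq
    by (intro continuous_on_vec_lambda continuous_intros)
qed auto

text \<open>The \<open>i\<close>-th inequality says that the \<open>i\<close>-th coordinate of the image is nonnegative.\<close>

lemma facet_embedding_polyhedron:
  "facet_embedding A b ` halfspace_polyhedron A b = range (facet_embedding A b) \<inter> {y. \<forall>i. 0 \<le> y $ i}"
proof -
  have "x \<in> halfspace_polyhedron A b \<longleftrightarrow> (\<forall>i. 0 \<le> facet_embedding A b x $ i)" for x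
    by (simp add: halfspace_polyhedron_def facet_embedding_def matrix_vector_mul_component
        inner_commute)
  then show ?thesis by auto
qed

lemma moment_map_nonneg [simp]: "0 \<le> moment_map z $ i"
  by (simp add: moment_map_def)

lemma moment_map_eq_sum_squares:
  "moment_map z $ i =
     square_map (real_coordinates z) $ Inl i + square_map (real_coordinates z) $ Inr i"
  by (simp add: moment_map_def square_map_def cmod_power2)

text \<open>
  Nonnegativity of the moment map removes the orthant condition on the left, as nonnegativity of
  squares does on the right; the remaining equations agree by \<open>moment_map_eq_sum_squares\<close>.
\<close>

lemma moment_angle_manifold_eq_vimage:
  assumes "range (facet_embedding A b) = affine_system_solutions k c q"
  shows "moment_angle_manifold A b =
         real_coordinates -` real_moment_angle_manifold (polytope_double k c q)"
proof -
  have "moment_angle_manifold A b = moment_map -` affine_system_solutions k c q"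
    unfolding moment_angle_manifold_def facet_embedding_polyhedron assms by auto
  also have "\<dots> = real_coordinates -` real_moment_angle_manifold (polytope_double k c q)"
    by (auto simp: affine_system_solutions_def real_moment_angle_manifold_def polytope_double_def
        moment_map_eq_sum_squares) (simp_all add: square_map_def)
  finally show ?thesis .
qed

theorem lemma6:
  fixes A :: "real ^ 'n ^ 'm" and b :: "real ^ 'm"
    and c :: "nat \<Rightarrow> 'm \<Rightarrow> real" and q :: "nat \<Rightarrow> real"
  assumes "simple_polytope (halfspace_polyhedron A b)"
    and "aff_dim (halfspace_polyhedron A b) = int CARD('n)"
    and "card {F. F facet_of halfspace_polyhedron A b} = CARD('m)"
    and "range (facet_embedding A b) = affine_system_solutions (CARD('m) - CARD('n)) c q"
  shows "moment_angle_manifold A b homeomorphic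
         real_moment_angle_manifold (polytope_double (CARD('m) - CARD('n)) c q)"
proof -
  let ?R = "real_moment_angle_manifold (polytope_double (CARD('m) - CARD('n)) c q)"
  have "real_coordinates ` moment_angle_manifold A b = ?R"
    unfolding moment_angle_manifold_eq_vimage[OF assms(4)]
    by (metis homeomorphism_real_coordinates homeomorphism_def surj_image_vimage_eq)
  then have "homeomorphism (moment_angle_manifold A b) ?R real_coordinates complex_coordinates"
    by (intro homeomorphism_of_subsets[OF homeomorphism_real_coordinates]) auto
  then show ?thesis
    unfolding homeomorphic_def by blast
qed

end
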